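(* Let $Y$ be a fence. The following are equivalent: (1) $Y$ is a smooth fence; (2) there is a closed partial order $\preceq$ on $Y$ whose restriction to each connected component of $Y$ is a total order and such that two elements of $Y$ are $\preceq$-comparable if and only if they belong to the same connected component; (3) there is a continuous injection $f:Y\to 2^{\mathbb N}\times[0,1]$; (4) there is a continuous injection $f:Y\to 2^{\mathbb N}\times[0,1]$ such that for each $x\in 2^{\mathbb N}$ the set $f[Y]\cap(\{x\}\times[0,1])$ is connected (possibly empty); (5) there are a closed nonempty $X\subseteq 2^{\mathbb N}$ and a fancy pair $(m,M)$ of functions on $X$ such that $Y$ is homeomorphic to $D_m^M=\{(x,y)\in X\times[0,1]: m(x)\le y\le M(x)\}$.
   Context: A fence is a compact metrizable space each of whose connected components is either a point or an arc. A fence $Y$ is smooth if there is a closed partial order on $Y$ (closed as a subset of $Y^2$) whose restriction to each connected component of $Y$ is a total order. A function $f:X\to[0,1]$ is lower semi-continuous if $\{x: f(x)\le y\}$ is closed for all $y$, and upper semi-continuous if $\{x:f(x)\ge y\}$ is closed for all $y$. For a zero-dimensional compact metrizable space $X$, a pair $(m,M)$ of functions $X\to[0,1]$ is a fancy pair if $m$ is lower semi-continuous, $M$ is upper semi-continuous, and $m(x)\le M(x)$ for all $x\in X$.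
   Formalization: The fence Y is assumed nonempty: the empty space satisfies (1)–(4) trivially but not (5), which requires X nonempty and hence D_m^M nonempty. *)

theory Defs
  imports "HOL-Analysis.Analysis"
begin

definition fence :: "'a topology \<Rightarrow> bool" where
  "fence Y \<longleftrightarrow> compact_space Y \<and> metrizable_space Y \<and>
     (\<forall>C \<in> connected_components_of Y.
        (\<exists>a. C = {a}) \<or> subtopology Y C homeomorphic_space top_of_set {0..1::real})"

definition closed_partial_order :: "'a topology \<Rightarrow> 'a rel \<Rightarrow> bool" where
  "closed_partial_order Y r \<longleftrightarrow>
     partial_order_on (topspace Y) r \<and> closedin (prod_topology Y Y) r"

definition total_on_components :: "'a topology \<Rightarrow> 'a rel \<Rightarrow> bool" where
  "total_on_components Y r \<longleftrightarrow>
     (\<forall>C \<in> connected_components_of Y. linear_order_on C (Restr r C))"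

definition smooth_fence :: "'a topology \<Rightarrow> bool" where
  "smooth_fence Y \<longleftrightarrow>
     fence Y \<and> (\<exists>r. closed_partial_order Y r \<and> total_on_components Y r)"

definition cantor_space :: "(nat \<Rightarrow> bool) topology" where
  "cantor_space = product_topology (\<lambda>_. discrete_topology UNIV) UNIV"

abbreviation cantor_times_interval :: "((nat \<Rightarrow> bool) \<times> real) topology" where
  "cantor_times_interval \<equiv> prod_topology cantor_space (top_of_set {0..1})"

definition lower_semicontinuous :: "'a topology \<Rightarrow> ('a \<Rightarrow> real) \<Rightarrow> bool" where
  "lower_semicontinuous T f \<longleftrightarrow> (\<forall>y \<in> {0..1}. closedin T {x \<in> topspace T. f x \<le> y})"

definition upper_semicontinuous :: "'a topology \<Rightarrow> ('a \<Rightarrow> real) \<Rightarrow> bool" where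
  "upper_semicontinuous T f \<longleftrightarrow> (\<forall>y \<in> {0..1}. closedin T {x \<in> topspace T. f x \<ge> y})"

text \<open>Semicontinuity is that of functions into the unit interval, hence the range of the
  levels \<open>y\<close>. The notion of fancy pair is meant for zero-dimensional compact metrizable \<open>T\<close>;
  it is only used for closed subspaces of the Cantor space, which have these properties.\<close>

definition fancy_pair :: "'a topology \<Rightarrow> ('a \<Rightarrow> real) \<Rightarrow> ('a \<Rightarrow> real) \<Rightarrow> bool" where
  "fancy_pair T m M \<longleftrightarrow>
     m \<in> topspace T \<rightarrow> {0..1} \<and> M \<in> topspace T \<rightarrow> {0..1} \<and>
     lower_semicontinuous T m \<and> upper_semicontinuous T M \<and>
     (\<forall>x \<in> topspace T. m x \<le> M x)"

definition between_graphs :: "'a set \<Rightarrow> ('a \<Rightarrow> real) \<Rightarrow> ('a \<Rightarrow> real) \<Rightarrow> ('a \<times> real) set" where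
  "between_graphs X m M = {(x, y). x \<in> X \<and> y \<in> {0..1} \<and> m x \<le> y \<and> y \<le> M x}"

end

theory Submission
  imports Defs
begin

text \<open>
  In a compact metrizable space components coincide with quasi-components, so countably many clopen
  sets separate them; this gives a continuous map \<open>g\<close> into the Cantor space whose fibres are
  exactly the components, and shows that intersecting a closed order with the component relation
  keeps it closed. Urysohn's construction carried out with open down-sets (Nachbin) separates
  \<open>a < b\<close> by a continuous monotone function into the unit interval. Countably many of these
  suffice, and their weighted sum \<open>h\<close> is strictly increasing along the order. Then
  \<open>x \<mapsto> (g x, h x)\<close> is injective with connected vertical sections, whose minima and maxima form the
  fancy pair. Conversely, any injection into the product pulls the vertical order back to \<open>Y\<close>.
\<close>

section \<open>Countable subfamilies of open sets with the same union\<close>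

text \<open>Open sets of a metrizable space are countable unions of closed sets, and these are
  compact here. Each closed piece of the union therefore needs only finitely many of the
  \<open>P i\<close>. The union may be a proper subset of the space.\<close>

lemma compact_metrizable_countable_subcover:
  assumes "compact_space Z" "metrizable_space Z" "\<And>i. i \<in> I \<Longrightarrow> openin Z (P i)"
  obtains J where "countable J" "J \<subseteq> I" "(\<Union>i\<in>J. P i) = (\<Union>i\<in>I. P i)"
proof -
  have "fsigma_in Z (\<Union>i\<in>I. P i)"
    using assms by (intro open_imp_fsigma_in openin_Union) auto
  then obtain C :: "nat \<Rightarrow> _" where C: "\<And>n. closedin Z (C n)" "\<Union> (range C) = (\<Union>i\<in>I. P i)"
    unfolding fsigma_in_ascending by blast
  have "\<exists>F. finite F \<and> F \<subseteq> I \<and> C n \<subseteq> (\<Union>i\<in>F. P i)" for n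
  proof -
    have "compactin Z (C n)"
      using C(1) assms(1) closedin_compact_space by blast
    moreover have "C n \<subseteq> \<Union> (P ` I)" using C(2) by blast
    ultimately obtain \<F> where "finite \<F>" "\<F> \<subseteq> P ` I" "C n \<subseteq> \<Union>\<F>"
      using assms(3) unfolding compactin_def by (metis (no_types, lifting) imageE)
    then show ?thesis
      by (metis finite_subset_image)
  qed
  then obtain F where F: "\<And>n. finite (F n)" "\<And>n. F n \<subseteq> I" "\<And>n. C n \<subseteq> (\<Union>i\<in>F n. P i)"
    by metis
  show ?thesis
  proof
    show "countable (\<Union>n. F n)"
      using F(1) by (intro countable_UN) (auto intro: countable_finite)
    show "(\<Union>n. F n) \<subseteq> I" using F(2) by blast
    have "(\<Union>n. C n) \<subseteq> (\<Union>n. \<Union>i\<in>F n. P i)" "(\<Union>n. \<Union>i\<in>F n. P i) \<subseteq> (\<Union>i\<in>I. P i)"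
      using F(2,3) by (intro UN_mono UN_least; simp add: UN_upper subsetD SUP_subset_mono)+
    then show "(\<Union>i\<in>(\<Union>n. F n). P i) = (\<Union>i\<in>I. P i)"
      using C(2) by simp
  qed
qed

lemma compact_metrizable_subcover_sequence:
  assumes "compact_space Z" "metrizable_space Z" "\<And>i. i \<in> I \<Longrightarrow> openin Z (P i)" "I \<noteq> {}"
  obtains g :: "nat \<Rightarrow> 'i" where "range g \<subseteq> I" "(\<Union>n. P (g n)) = (\<Union>i\<in>I. P i)"
proof -
  obtain J where J: "countable J" "J \<subseteq> I" "(\<Union>i\<in>J. P i) = (\<Union>i\<in>I. P i)"
    by (rule compact_metrizable_countable_subcover[OF assms(1-3)])
  obtain i0 where "i0 \<in> I" using assms(4) by blast
  \<comment> \<open>\<open>J\<close> may be empty, for instance when every \<open>P i\<close> is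
    empty. Adding \<open>i0\<close> gives \<open>from_nat_into\<close> a nonempty set to enumerate
    and leaves the union unchanged.\<close>
  have "countable (insert i0 J)" "insert i0 J \<noteq> {}"
    using J(1) by auto
  then have "range (from_nat_into (insert i0 J)) = insert i0 J"
    by simp
  moreover have "(\<Union>i\<in>insert i0 J. P i) = (\<Union>i\<in>I. P i)"
    using J(3) \<open>i0 \<in> I\<close> by auto
  ultimately show ?thesis
    using that[of "from_nat_into (insert i0 J)"] J(2) \<open>i0 \<in> I\<close>
    by (simp flip: image_image)
qed

section \<open>Closed relations on compact spaces\<close>

text \<open>The image of \<open>K\<close> is the projection of the part of \<open>r\<close> over
  \<open>K\<close>, and projecting along a compact factor is a closed map. For a closed order this
  makes up-closures of closed sets closed, and, applied to the converse, down-closures as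
  well.\<close>

lemma closedin_relation_Image:
  assumes "compact_space Y" "closedin (prod_topology Y Z) r" "closedin Y K"
  shows "closedin Z (r `` K)"
proof -
  have "closedin (prod_topology Y Z) (r \<inter> K \<times> topspace Z)"
    using assms by (intro closedin_Int) (auto simp: closedin_prod_Times_iff)
  then have "closedin Z (snd ` (r \<inter> K \<times> topspace Z))"
    using closed_map_snd[OF assms(1)] unfolding closed_map_def by blast
  moreover have "snd ` (r \<inter> K \<times> topspace Z) = r `` K"
    using closedin_subset[OF assms(2)] by force
  ultimately show ?thesis by simp
qed

lemma closedin_prod_converse:
  assumes "closedin (prod_topology Y Z) r"
  shows "closedin (prod_topology Z Y) (r\<inverse>)"
proof -
  have "continuous_map (prod_topology Z Y) (prod_topology Y Z) (\<lambda>p. (snd p, fst p))"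
    by (intro continuous_intros continuous_map_fst continuous_map_snd)
  then have "closedin (prod_topology Z Y)
      {p \<in> topspace (prod_topology Z Y). (snd p, fst p) \<in> r}"
    using assms closedin_continuous_map_preimage by blast
  moreover have "{p \<in> topspace (prod_topology Z Y). (snd p, fst p) \<in> r} = r\<inverse>"
    using closedin_subset[OF assms] by force
  ultimately show ?thesis by simp
qed

section \<open>Urysohn separation by open down-sets\<close>

text \<open>Being closed under \<open>r\<inverse>\<close> means being a down-set. Normality gives an
  open \<open>U\<close> between \<open>A\<close> and \<open>V\<close>; deleting the up-closure of
  its complement leaves a down-set. This is open because that up-closure is closed, and it still
  contains \<open>A\<close> because \<open>A\<close> is a down-set inside \<open>U\<close>.\<close>

lemma closed_partial_order_interpolation:
  assumes Y: "compact_space Y" "normal_space Y" and r: "closed_partial_order Y r"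
    and A: "closedin Y A" "r\<inverse> `` A \<subseteq> A" and V: "openin Y V" and AV: "A \<subseteq> V"
  obtains W where "openin Y W" "r\<inverse> `` W \<subseteq> W" "A \<subseteq> W" "Y closure_of W \<subseteq> V"
proof -
  have po: "refl_on (topspace Y) r" "trans r" "r \<subseteq> topspace Y \<times> topspace Y"
    and clo: "closedin (prod_topology Y Y) r"
    using r partial_order_onD[of "topspace Y" r] unfolding closed_partial_order_def by blast+
  obtain U where U: "openin Y U" "A \<subseteq> U" "Y closure_of U \<subseteq> V"
    using Y(2) A(1) V AV unfolding normal_space_alt by metis
  \<comment> \<open>the largest down-set inside \<open>U\<close>\<close>
  define W where "W = topspace Y - r `` (topspace Y - U)"
  show ?thesis
  proof
    show "openin Y W"
      unfolding W_def using closedin_relation_Image[OF Y(1) clo] U(1) by blast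
    show "r\<inverse> `` W \<subseteq> W"
      unfolding W_def using po(2,3) by (auto dest: transD)
    show "A \<subseteq> W"
      unfolding W_def using A(2) U(2) closedin_subset[OF A(1)] by blast
    have "W \<subseteq> U"
      unfolding W_def using po(1) by (auto simp: refl_on_def)
    then show "Y closure_of W \<subseteq> V"
      using U(3) closure_of_mono by blast
  qed
qed

text \<open>Two dyadics straddle \<open>a\<close> at distance less than \<open>b - a\<close>, so the
  upper one lies below \<open>b\<close>. The set \<open>dyadics\<close> contains only nonnegative
  numbers.\<close>

lemma dyadic_between:
  assumes "0 \<le> a" "a < b"
  obtains r :: real where "r \<in> dyadics" "a < r" "r < b"
proof -
  obtain n q r where "of_nat q / 2^n \<le> a" "a < of_nat r / 2^n"
      "\<bar>of_nat q / 2^n - of_nat r / 2^n\<bar> < b - a"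
    using padic_rational_approximation_straddle_pos_le[of "b - a" 2 a] assms
    by (metis diff_gt_0_iff_gt one_less_numeral_iff semiring_norm(76))
  then show ?thesis
    using that[of "of_nat r / 2^n"] by (auto simp: dyadics_def)
qed

text \<open>In Urysohn's construction every set of the dyadic family is chosen to be a down-set, so
  a smaller point lies in at least as many of them and receives a value that is no larger. The point
  \<open>a\<close> lies in the first set and \<open>b\<close> outside the last.\<close>

lemma closed_partial_order_Urysohn:
  assumes Y: "compact_space Y" "Hausdorff_space Y" and r: "closed_partial_order Y r"
    and ab: "a \<in> topspace Y" "b \<in> topspace Y" "(b, a) \<notin> r"
  obtains h where "continuous_map Y (top_of_set {0..1::real}) h"
    "\<And>x y. (x, y) \<in> r \<Longrightarrow> h x \<le> h y" "h a < h b"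
proof -
  have po: "refl_on (topspace Y) r" "trans r" "r \<subseteq> topspace Y \<times> topspace Y"
    and clo: "closedin (prod_topology Y Y) r"
    using r partial_order_onD[of "topspace Y" r] unfolding closed_partial_order_def by blast+
  have nor: "normal_space Y"
    using Y compact_Hausdorff_or_regular_imp_normal_space by blast
  have clo_sing: "closedin Y {x}" if "x \<in> topspace Y" for x
    using Y(2) that by (simp add: closedin_Hausdorff_singleton)
  note down = closedin_relation_Image[OF Y(1) closedin_prod_converse[OF clo]]
  \<comment> \<open>The dyadic recursion only propagates a binary relation, so openness and being a
    down-set are built into \<open>R\<close> for both arguments.\<close>
  define R where "R U V \<longleftrightarrow> openin Y U \<and> openin Y V \<and> r\<inverse> `` U \<subseteq> U \<and> r\<inverse> `` V \<subseteq> V \<and>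
      Y closure_of U \<subseteq> V" for U V
  \<comment> \<open>This is the largest down-set avoiding \<open>b\<close>. It contains everything
    below \<open>a\<close>, since otherwise transitivity would put \<open>b\<close> below
    \<open>a\<close>.\<close>
  define V where "V = topspace Y - r `` {b}"
  have V: "openin Y V" "r\<inverse> `` V \<subseteq> V"
    unfolding V_def using closedin_relation_Image[OF Y(1) clo clo_sing[OF ab(2)]] po(2,3)
    by (auto dest: transD)
  obtain U where U: "openin Y U" "r\<inverse> `` U \<subseteq> U" "r\<inverse> `` {a} \<subseteq> U" "Y closure_of U \<subseteq> V"
  proof (rule closed_partial_order_interpolation[OF Y(1) nor r down[OF clo_sing[OF ab(1)]] _ V(1)])
    show "r\<inverse> `` r\<inverse> `` {a} \<subseteq> r\<inverse> `` {a}"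
      using po(2) by (auto dest: transD)
    show "r\<inverse> `` {a} \<subseteq> V"
      unfolding V_def using po(2,3) ab(3) by (auto dest: transD)
  qed blast
  have "\<exists>G :: real \<Rightarrow> 'a set. G 0 = U \<and> G 1 = V \<and>
      (\<forall>x \<in> dyadics \<inter> {0..1}. \<forall>y \<in> dyadics \<inter> {0..1}. x < y \<longrightarrow> R (G x) (G y))"
  proof (rule recursion_on_dyadic_fractions)
    show "R U V" using U V by (auto simp: R_def)
    show "\<exists>W. R S W \<and> R W T" if RST: "R S T" for S T
    proof -
      \<comment> \<open>The closure of a down-set need not visibly be a down-set, so the
        interpolation starts from its down-closure. That set is closed, and it stays inside
        \<open>T\<close> because \<open>T\<close> is a down-set.\<close>
      have S: "Y closure_of S \<subseteq> r\<inverse> `` (Y closure_of S)"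
        using po(1) closure_of_subset_topspace[of Y S] unfolding refl_on_def by blast
      obtain W where "openin Y W" "r\<inverse> `` W \<subseteq> W" "r\<inverse> `` (Y closure_of S) \<subseteq> W" "Y closure_of W \<subseteq> T"
      proof (rule closed_partial_order_interpolation[OF Y(1) nor r down[OF closedin_closure_of]])
        show "r\<inverse> `` r\<inverse> `` (Y closure_of S) \<subseteq> r\<inverse> `` (Y closure_of S)"
          using po(2) by (blast dest: transD)
        show "openin Y T" "r\<inverse> `` (Y closure_of S) \<subseteq> T"
          using RST unfolding R_def by blast+
      qed blast
      then have "R S W \<and> R W T"
        using S RST unfolding R_def by (metis order_trans)
      then show ?thesis ..
    qed
    show "R S T'" if "R S T" "R T T'" for S T T'
      using that closure_of_subset[OF openin_subset, of Y T] unfolding R_def by (metis order_trans)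
  qed
  then obtain G :: "real \<Rightarrow> 'a set" where G0: "G 0 = U" and G1: "G 1 = V"
    and G: "\<And>x y. \<lbrakk>x \<in> dyadics \<inter> {0..1}; y \<in> dyadics \<inter> {0..1}; x < y\<rbrakk> \<Longrightarrow> R (G x) (G y)"
    by blast
  define D where "D = (dyadics \<inter> {0..1} :: real set)"
  have D01: "0 \<in> D" "1 \<in> D"
    unfolding D_def by (force simp: dyadics_def)+
  have Gop: "openin Y (G s)" and Gdown: "r\<inverse> `` (G s) \<subseteq> G s" if "s \<in> D" for s
  proof -
    \<comment> \<open>The recursion speaks only of pairs of distinct indices; pairing
      \<open>s\<close> with 1 recovers the properties of the single set \<open>G s\<close>, and
      \<open>G 1\<close> is \<open>V\<close>.\<close>
    have "s = 1 \<or> R (G s) (G 1)"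
      using G[of s 1] that D01 unfolding D_def by force
    then show "openin Y (G s)" "r\<inverse> `` (G s) \<subseteq> G s"
      using V unfolding R_def G1[symmetric] by metis+
  qed
  have Gcl: "Y closure_of (G s) \<subseteq> G t" if "s \<in> D" "t \<in> D" "s < t" for s t
    using G that unfolding D_def R_def by blast
  have Gmono: "G s \<subseteq> G t" if "s \<in> D" "t \<in> D" "s \<le> t" for s t
    using Gcl[of s t] that closure_of_subset[OF openin_subset[OF Gop[of s]]]
    by (cases "s = t") auto
  \<comment> \<open>The inserted 1 keeps the set nonempty and is the value at points lying in no
    \<open>G s\<close>.\<close>
  define f where "f x = Inf (insert 1 {s \<in> D. x \<in> G s})" for x
  have bdd: "bdd_below (insert 1 {s \<in> D. x \<in> G s})" for x
    by (auto simp: D_def bdd_below_def intro!: exI[of _ 0])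
  have f_le: "f x \<le> s" if "s \<in> D" "x \<in> G s" for x s
    unfolding f_def using that bdd by (intro cInf_lower) auto
  have f_le1: "f x \<le> 1" for x
    unfolding f_def using bdd by (intro cInf_lower) auto
  have f_ge: "s \<le> f x" if "s \<in> D" "x \<notin> G s" for x s
  proof -
    have "s \<le> t" if "t \<in> D" "x \<in> G t" for t
      using Gmono[of t s] that \<open>s \<in> D\<close> \<open>x \<notin> G s\<close> by force
    then show ?thesis
      unfolding f_def using \<open>s \<in> D\<close> by (intro cInf_greatest) (auto simp: D_def)
  qed
  have f_ge0: "0 \<le> f x" for x
    unfolding f_def by (intro cInf_greatest) (auto simp: D_def)
  \<comment> \<open>For \<open>c \<le> 1\<close> the default 1 is not below \<open>c\<close>, so the
    witness is a genuine index. The strict sublevel set is then a union of open sets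
    \<open>G s\<close>.\<close>
  have f_less: "f x < c \<longleftrightarrow> (\<exists>s\<in>D. s < c \<and> x \<in> G s)" if "c \<le> 1" for x c
  proof
    assume "f x < c"
    then obtain s where "s \<in> insert 1 {s \<in> D. x \<in> G s}" "s < c"
      using cInf_lessD[of "insert 1 {s \<in> D. x \<in> G s}" c] unfolding f_def by blast
    then show "\<exists>s\<in>D. s < c \<and> x \<in> G s" using that by auto
  next
    assume "\<exists>s\<in>D. s < c \<and> x \<in> G s"
    then show "f x < c" using f_le le_less_trans by blast
  qed
  have f_gr: "f x > c \<longleftrightarrow> (\<exists>s\<in>D. s > c \<and> x \<notin> Y closure_of (G s))"
    if c: "0 \<le> c" and "x \<in> topspace Y" for x c
  proof
    assume "f x > c"
    \<comment> \<open>Two dyadics are taken between \<open>c\<close> and \<open>f x\<close>: the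
      point is outside \<open>G t\<close>, and the closure of \<open>G s\<close> lies inside
      \<open>G t\<close>. Complements of closures make the superlevel set open.\<close>
    then obtain t where t: "t \<in> dyadics" "c < t" "t < f x"
      using dyadic_between[OF c] by blast
    obtain s where s: "s \<in> dyadics" "c < s" "s < t"
      using dyadic_between[OF c t(2)] by blast
    have "s \<in> D" "t \<in> D" using s t f_le1[of x] c by (auto simp: D_def)
    then show "\<exists>s\<in>D. s > c \<and> x \<notin> Y closure_of (G s)"
      using Gcl[of s t] s t f_le[of t x] by (meson not_le subsetD)
  next
    assume "\<exists>s\<in>D. s > c \<and> x \<notin> Y closure_of (G s)"
    then obtain s where "s \<in> D" "s > c" "x \<notin> G s"
      using closure_of_subset[OF openin_subset[OF Gop]] by blast
    then show "f x > c" using f_ge less_le_trans by blast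
  qed
  show ?thesis
  proof
    have "openin Y {x \<in> topspace Y. f x > c}" for c
    proof (cases "c \<ge> 0")
      case True
      have "{x \<in> topspace Y. f x > c} = (\<Union>s\<in>{s\<in>D. s > c}. topspace Y - Y closure_of (G s))"
        using f_gr[OF True] by auto
      moreover have "openin Y (\<Union>s\<in>{s\<in>D. s > c}. topspace Y - Y closure_of (G s))"
        by (intro openin_Union) auto
      ultimately show ?thesis by (simp only:)
    next
      case False
      then have "{x \<in> topspace Y. f x > c} = topspace Y"
        using f_ge0 by (auto simp: not_le intro: less_le_trans)
      then show ?thesis by simp
    qed
    moreover have "openin Y {x \<in> topspace Y. f x < c}" for c
    proof (cases "c \<le> 1")
      case True
      have "{x \<in> topspace Y. f x < c} = (\<Union>s\<in>{s\<in>D. s < c}. G s)"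
        using f_less[OF True] openin_subset[OF Gop] by auto
      moreover have "openin Y (\<Union>s\<in>{s\<in>D. s < c}. G s)"
        using Gop by (intro openin_Union) auto
      ultimately show ?thesis by (simp only:)
    next
      case False
      then have "{x \<in> topspace Y. f x < c} = topspace Y"
        using f_le1 by (auto simp: not_le intro: le_less_trans)
      then show ?thesis by simp
    qed
    ultimately show "continuous_map Y (top_of_set {0..1}) f"
      using f_ge0 f_le1 by (simp add: continuous_map_upper_lower_semicontinuous_lt_gen)
    show "f x \<le> f y" if "(x, y) \<in> r" for x y
    proof -
      have "{s \<in> D. y \<in> G s} \<subseteq> {s \<in> D. x \<in> G s}"
        using Gdown that by blast
      then show ?thesis
        unfolding f_def by (intro cInf_superset_mono bdd) auto
    qed
    have "a \<in> G 0" using U(3) G0 po(1) ab(1) by (auto simp: refl_on_def)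
    moreover have "b \<notin> G 1" unfolding G1 V_def using po(1) ab(2) by (auto simp: refl_on_def)
    ultimately show "f a < f b"
      using f_le[of 0 a] f_ge[of 1 b] D01 by linarith
  qed
qed

section \<open>A continuous strictly increasing function\<close>

lemma compact_metrizable_square:
  assumes "compact_space Y" "metrizable_space Y"
  shows "compact_space (prod_topology Y Y)" "metrizable_space (prod_topology Y Y)"
  using assms by (auto simp: compact_space_prod_topology metrizable_space_prod_topology)

lemma openin_continuous_map_less:
  fixes h :: "'a \<Rightarrow> real"
  assumes "continuous_map Y euclideanreal h"
  shows "openin (prod_topology Y Y) {p \<in> topspace (prod_topology Y Y). h (fst p) < h (snd p)}"
proof -
  have "continuous_map (prod_topology Y Y) euclideanreal (\<lambda>p. h (fst p))"
       "continuous_map (prod_topology Y Y) euclideanreal (\<lambda>p. h (snd p))"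
    using continuous_map_compose[OF continuous_map_fst assms]
      continuous_map_compose[OF continuous_map_snd assms] by (auto simp: comp_def)
  then have "continuous_map (prod_topology Y Y) euclideanreal (\<lambda>p. h (snd p) - h (fst p))"
    by (intro continuous_intros)
  then show ?thesis
    by (auto simp: continuous_map_upper_lower_semicontinuous_lt dest!: spec[of _ 0])
qed

text \<open>By the Weierstrass M-test the partial sums converge uniformly, and a uniform limit of
  continuous maps is continuous.\<close>

lemma continuous_map_suminf:
  fixes g :: "nat \<Rightarrow> 'a \<Rightarrow> real"
  assumes "\<And>n. continuous_map Y euclideanreal (g n)"
    and "\<And>n x. x \<in> topspace Y \<Longrightarrow> norm (g n x) \<le> B n" and "summable B"
  shows "continuous_map Y euclideanreal (\<lambda>x. \<Sum>n. g n x)"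
proof -
  have lim: "uniform_limit (topspace Y) (\<lambda>n x. \<Sum>i<n. g i x) (\<lambda>x. \<Sum>i. g i x) sequentially"
    using assms(2,3) by (intro Weierstrass_m_test)
  \<comment> \<open>\<open>Met_TC\<close> presents the type-class distance as an abstract metric,
    the setting of the uniform limit theorem; its topology on the reals is the Euclidean
    one.\<close>
  have "continuous_map Y Met_TC.mtopology (\<lambda>x. \<Sum>i. g i x)"
  proof (rule Met_TC.continuous_map_uniform_limit_alt)
    show "\<forall>\<^sub>F n in sequentially. continuous_map Y Met_TC.mtopology (\<lambda>x. \<Sum>i<n. g i x)"
      using assms(1) by (intro always_eventually allI) (auto intro!: continuous_map_sum)
    show "\<forall>\<^sub>F n in sequentially. \<forall>x\<in>topspace Y. dist (\<Sum>i<n. g i x) (\<Sum>i. g i x) < e"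
      if "e > 0" for e
      using lim that by (auto simp: uniform_limit_iff)
  qed auto
  then show ?thesis by simp
qed

text \<open>Each continuous monotone function strictly increases on an open set of pairs in the
  compact metrizable square, so a sequence of them already separates every pair that some such
  function separates. In the weighted sum all differences along the order are nonnegative and at
  least one is positive.\<close>

lemma closed_partial_order_strict_mono_function:
  assumes Y: "compact_space Y" "metrizable_space Y" and r: "closed_partial_order Y r"
  obtains h where "continuous_map Y (top_of_set {0..1::real}) h"
    "\<And>x y. \<lbrakk>(x, y) \<in> r; x \<noteq> y\<rbrakk> \<Longrightarrow> h x < h y"
proof -
  have po: "antisym r" "r \<subseteq> topspace Y \<times> topspace Y"
    using r partial_order_onD[of "topspace Y" r] unfolding closed_partial_order_def by blast+
  define I where "I = {h. continuous_map Y (top_of_set {0..1::real}) h \<and>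
      (\<forall>x y. (x, y) \<in> r \<longrightarrow> h x \<le> h y)}"
  define P where "P h = {p \<in> topspace (prod_topology Y Y). h (fst p) < h (snd p)}" for h :: "'a \<Rightarrow> real"
  have "(\<lambda>x. 0) \<in> I" by (auto simp: I_def)
  then have "I \<noteq> {}" by blast
  have op: "openin (prod_topology Y Y) (P h)" if "h \<in> I" for h
    unfolding P_def using that
    by (intro openin_continuous_map_less) (auto simp: I_def continuous_map_in_subtopology)
  obtain g :: "nat \<Rightarrow> 'a \<Rightarrow> real" where g: "range g \<subseteq> I" "(\<Union>n. P (g n)) = (\<Union>h\<in>I. P h)"
    by (rule compact_metrizable_subcover_sequence[OF compact_metrizable_square[OF Y] op \<open>I \<noteq> {}\<close>])
  have g_cont: "continuous_map Y euclideanreal (g n)"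
    and g_01: "x \<in> topspace Y \<Longrightarrow> 0 \<le> g n x \<and> g n x \<le> 1"
    and g_mono: "(x, y) \<in> r \<Longrightarrow> g n x \<le> g n y" for n x y
    using g(1) by (auto simp: I_def continuous_map_in_subtopology Pi_iff)
  \<comment> \<open>The exponent starts at 1 so that the weights sum to exactly 1 and the total
    stays in the unit interval.\<close>
  define G where "G n x = g n x * (1/2)^Suc n" for n x
  have sB: "summable (\<lambda>n. (1/2)^Suc n :: real)" "(\<Sum>n. (1/2)^Suc n) = (1::real)"
    using power_half_series by (auto simp: sums_iff)
  have G_bd: "0 \<le> G n x" "G n x \<le> (1/2)^Suc n" if "x \<in> topspace Y" for n x
    using g_01[OF that, of n] by (auto simp: G_def mult_le_cancel_right1)
  have G_sum: "summable (\<lambda>n. G n x)" if "x \<in> topspace Y" for x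
    using G_bd[OF that] by (intro summable_comparison_test'[OF sB(1)]) auto
  define h where "h x = (\<Sum>n. G n x)" for x
  show ?thesis
  proof
    have "continuous_map Y euclideanreal h"
      unfolding h_def
    proof (rule continuous_map_suminf[OF _ _ sB(1)])
      show "continuous_map Y euclideanreal (G n)" for n
        unfolding G_def using g_cont by (intro continuous_intros)
    qed (use G_bd in auto)
    moreover have "0 \<le> h x" "h x \<le> 1" if "x \<in> topspace Y" for x
      using suminf_nonneg[OF G_sum[OF that]] suminf_le[OF _ G_sum[OF that] sB(1)] G_bd[OF that]
      unfolding h_def sB(2) by blast+
    ultimately show "continuous_map Y (top_of_set {0..1}) h"
      by (auto simp: continuous_map_in_subtopology)
    show "h x < h y" if xy: "(x, y) \<in> r" "x \<noteq> y" for x y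
    proof -
      \<comment> \<open>Antisymmetry turns \<open>x\<close> strictly below \<open>y\<close> into
        \<open>(y, x) \<notin> r\<close>, the form required for separation.\<close>
      have top: "x \<in> topspace Y" "y \<in> topspace Y" and "(y, x) \<notin> r"
        using xy po by (auto dest: antisymD)
      then obtain f where "f \<in> I" "f x < f y"
        using closed_partial_order_Urysohn[OF Y(1) metrizable_imp_Hausdorff_space[OF Y(2)] r]
        unfolding I_def by blast
      then have "(x, y) \<in> (\<Union>h\<in>I. P h)"
        using top by (auto simp: P_def)
      then obtain n where "(x, y) \<in> P (g n)"
        using g(2) by blast
      then have "0 < G n y - G n x"
        by (simp add: P_def G_def)
      moreover have "0 \<le> G m y - G m x" for m
        using g_mono[OF xy(1), of m] by (simp add: G_def)
      ultimately have "0 < (\<Sum>n. G n y - G n x)"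
        using top by (intro suminf_pos2[where i=n] summable_diff G_sum) auto
      then show ?thesis
        using suminf_diff[OF G_sum[OF top(2)] G_sum[OF top(1)]] by (simp add: h_def)
    qed
  qed
qed

section \<open>Components and maps into the Cantor space\<close>

lemma continuous_map_discrete_bool:
  assumes "closedin Y K" "openin Y K"
  shows "continuous_map Y (discrete_topology UNIV) (\<lambda>x. x \<in> K)"
proof -
  have "openin Y {x \<in> topspace Y. (x \<in> K) \<in> U}" for U
  proof -
    have "{x \<in> topspace Y. (x \<in> K) \<in> U} =
        (if True \<in> U then K else {}) \<union> (if False \<in> U then topspace Y - K else {})"
      using openin_subset[OF assms(2)] by (auto split: if_splits) (metis (full_types))+
    then show ?thesis
      using assms by (simp add: openin_Un openin_diff)
  qed
  then show ?thesis
    by (simp add: continuous_map)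
qed

text \<open>In a compact Hausdorff space components are quasi-components, so points of different
  components are split by a clopen \<open>K\<close>. The open rectangles of \<open>K\<close> times
  its complement thus cover all such pairs; countably many cover the same set, and \<open>g\<close>
  records membership in the corresponding clopen sets.\<close>

lemma component_map_to_cantor_space:
  assumes Y: "compact_space Y" "metrizable_space Y"
  obtains g where "continuous_map Y cantor_space g"
    "\<And>x y. \<lbrakk>x \<in> topspace Y; y \<in> topspace Y\<rbrakk> \<Longrightarrow> g x = g y \<longleftrightarrow> connected_component_of Y x y"
proof -
  have quasi: "quasi_component_of Y = connected_component_of Y"
    using Y metrizable_imp_Hausdorff_space by (intro ext fun_cong[OF quasi_eq_connected_component_of]) auto
  define I where "I = {K. closedin Y K \<and> openin Y K}"
  have "{} \<in> I" by (auto simp: I_def)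
  then have "I \<noteq> {}" by blast
  have op: "openin (prod_topology Y Y) (K \<times> (topspace Y - K))" if "K \<in> I" for K
    using that by (auto simp: I_def openin_prod_Times_iff)
  obtain k :: "nat \<Rightarrow> 'a set" where k: "range k \<subseteq> I"
      "(\<Union>n. k n \<times> (topspace Y - k n)) = (\<Union>K\<in>I. K \<times> (topspace Y - K))"
    by (rule compact_metrizable_subcover_sequence[OF compact_metrizable_square[OF Y] op \<open>I \<noteq> {}\<close>])
  define g where "g x = (\<lambda>n. x \<in> k n)" for x
  show ?thesis
  proof
    show "continuous_map Y cantor_space g"
      unfolding cantor_space_def continuous_map_componentwise_UNIV g_def
      using k(1) by (auto simp: I_def intro!: continuous_map_discrete_bool)
    show "g x = g y \<longleftrightarrow> connected_component_of Y x y" if xy: "x \<in> topspace Y" "y \<in> topspace Y" for x y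
    proof
      assume "connected_component_of Y x y"
      then show "g x = g y"
        using k(1) unfolding quasi[symmetric] quasi_component_of_def g_def I_def by blast
    next
      assume eq: "g x = g y"
      have "y \<in> T" if "x \<in> T" "T \<in> I" for T
      proof (rule ccontr)
        assume "y \<notin> T"
        then have "(x, y) \<in> (\<Union>K\<in>I. K \<times> (topspace Y - K))"
          using xy that by blast
        then obtain n where "(x, y) \<in> k n \<times> (topspace Y - k n)"
          using k(2) by blast
        then show False
          using fun_cong[OF eq, of n] by (auto simp: g_def)
      qed
      then show "connected_component_of Y x y"
        unfolding quasi[symmetric] quasi_component_of using xy by (auto simp: I_def)
    qed
  qed
qed

lemma compact_cantor_space: "compact_space cantor_space"
  by (simp add: cantor_space_def compact_space_product_topology compact_space_discrete_topology)

lemma Hausdorff_cantor_space: "Hausdorff_space cantor_space"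
  by (simp add: cantor_space_def Hausdorff_space_product_topology)

lemma topspace_cantor_space [simp]: "topspace cantor_space = UNIV"
  by (simp add: cantor_space_def)

lemma Hausdorff_cantor_times_interval: "Hausdorff_space cantor_times_interval"
  by (simp add: Hausdorff_space_prod_topology Hausdorff_cantor_space Hausdorff_space_subtopology)

text \<open>The component relation is the kernel of a continuous map into a Hausdorff space, that
  is, the preimage of a closed diagonal.\<close>

lemma closedin_connected_component_of_relation:
  assumes "compact_space Y" "metrizable_space Y"
  shows "closedin (prod_topology Y Y) {(x, y). connected_component_of Y x y}"
proof -
  obtain g where g: "continuous_map Y cantor_space g"
    "\<And>x y. \<lbrakk>x \<in> topspace Y; y \<in> topspace Y\<rbrakk> \<Longrightarrow> g x = g y \<longleftrightarrow> connected_component_of Y x y"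
    using component_map_to_cantor_space[OF assms] by blast
  have "closedin (prod_topology Y Y) {p \<in> topspace (prod_topology Y Y). g (fst p) = g (snd p)}"
    using continuous_map_compose[OF continuous_map_fst g(1)]
      continuous_map_compose[OF continuous_map_snd g(1)]
    by (intro closedin_continuous_maps_eq[OF Hausdorff_cantor_space]) (auto simp: comp_def)
  also have "{p \<in> topspace (prod_topology Y Y). g (fst p) = g (snd p)} =
      {(x, y). connected_component_of Y x y}"
    using g(2) connected_component_of_equiv[of Y] by auto
  finally show ?thesis .
qed

lemma connected_components_ofD:
  assumes "C \<in> connected_components_of Y" "x \<in> C" "y \<in> C"
  shows "x \<in> topspace Y" "connected_component_of Y x y"
proof -
  show "x \<in> topspace Y"
    using assms(1,2) connected_components_of_subset by blast
  show "connected_component_of Y x y"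
    using assms connectedin_connected_components_of unfolding connected_component_of_def by blast
qed

text \<open>Intersecting \<open>r\<close> with the closed equivalence relation \<open>E\<close> of
  lying in one component preserves closedness and the order axioms, changes nothing inside a
  component, and removes all comparabilities across components.\<close>

lemma closed_partial_order_within_components:
  assumes Y: "compact_space Y" "metrizable_space Y"
    and r: "closed_partial_order Y r" "total_on_components Y r"
  obtains s where "closed_partial_order Y s" "total_on_components Y s"
    "\<And>x y. \<lbrakk>x \<in> topspace Y; y \<in> topspace Y\<rbrakk> \<Longrightarrow>
       (x, y) \<in> s \<or> (y, x) \<in> s \<longleftrightarrow> connected_component_of Y x y"
proof -
  define E where "E = {(x, y). connected_component_of Y x y}"
  have po: "refl_on (topspace Y) r" "trans r" "antisym r" "r \<subseteq> topspace Y \<times> topspace Y"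
    and clo: "closedin (prod_topology Y Y) r"
    using r(1) partial_order_onD[of "topspace Y" r] unfolding closed_partial_order_def by blast+
  have E: "refl_on (topspace Y) E" "trans E" "sym E"
    by (auto simp: E_def refl_on_def connected_component_of_refl connected_component_of_sym
        intro!: transI symI intro: connected_component_of_trans)
  show ?thesis
  proof
    have "partial_order_on (topspace Y) (r \<inter> E)"
      using po E(1,2) by (auto simp: order_on_defs refl_on_def trans_Int intro: antisym_subset)
    moreover have "closedin (prod_topology Y Y) (r \<inter> E)"
      unfolding E_def using clo closedin_connected_component_of_relation[OF Y] by blast
    ultimately show "closed_partial_order Y (r \<inter> E)"
      by (simp add: closed_partial_order_def)
    have restr: "Restr (r \<inter> E) C = Restr r C" if "C \<in> connected_components_of Y" for C
      using connected_components_ofD(2)[OF that] by (auto simp: E_def)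
    then show "total_on_components Y (r \<inter> E)"
      using r(2) by (simp add: total_on_components_def)
    show "(x, y) \<in> r \<inter> E \<or> (y, x) \<in> r \<inter> E \<longleftrightarrow> connected_component_of Y x y"
      if xy: "x \<in> topspace Y" "y \<in> topspace Y" for x y
    proof
      assume "connected_component_of Y x y"
      moreover define C where "C = connected_component_of_set Y x"
      ultimately have C: "C \<in> connected_components_of Y" "x \<in> C" "y \<in> C"
        using xy by (auto simp: connected_components_of_def connected_component_of_refl)
      \<comment> \<open>\<open>total_on\<close> concerns distinct points only; reflexivity supplies
        the case \<open>x = y\<close>.\<close>
      then have "total_on C (Restr r C)" "(x, x) \<in> r"
        using r(2) po(1) xy by (auto simp: total_on_components_def linear_order_on_def refl_on_def)
      then have "(x, y) \<in> r \<or> (y, x) \<in> r"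
        using C by (cases "x = y") (auto simp: total_on_def)
      then show "(x, y) \<in> r \<inter> E \<or> (y, x) \<in> r \<inter> E"
        using connected_components_ofD(2)[OF C(1)] C by (auto simp: E_def)
    qed (use E(3) in \<open>auto simp: E_def connected_component_of_sym\<close>)
  qed
qed

section \<open>The order pulled back from an injection\<close>

text \<open>Each coordinate of \<open>g\<close> is continuous into a discrete space, so the set
  where it is true is clopen and cannot separate points of one component.\<close>

lemma connected_component_of_imp_eq_cantor:
  assumes "continuous_map Y cantor_space g" "connected_component_of Y x y"
  shows "g x = g y"
proof
  fix n
  have "continuous_map Y (discrete_topology UNIV) (\<lambda>z. g z n)"
    using assms(1) unfolding cantor_space_def continuous_map_componentwise_UNIV by blast
  then have "closedin Y {z \<in> topspace Y. g z n \<in> {True}}" "openin Y {z \<in> topspace Y. g z n \<in> {True}}"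
    by (auto simp only: intro!: closedin_continuous_map_preimage openin_continuous_map_preimage) auto
  then show "g x n = g y n"
    using connected_imp_quasi_component_of[OF assms(2)] unfolding quasi_component_of_def by blast
qed

text \<open>Points with equal first coordinate are compared by their second. Injectivity of
  \<open>f\<close> gives antisymmetry, and totality on components holds because the first coordinate
  is constant there.\<close>

lemma order_of_continuous_injection:
  assumes f: "continuous_map Y cantor_times_interval f" "inj_on f (topspace Y)"
  obtains r where "closed_partial_order Y r" "total_on_components Y r"
proof -
  define r where "r = {(x, y). x \<in> topspace Y \<and> y \<in> topspace Y \<and>
      fst (f x) = fst (f y) \<and> snd (f x) \<le> snd (f y)}"
  have cont: "continuous_map Y cantor_space (fst \<circ> f)" "continuous_map Y euclideanreal (snd \<circ> f)"
    using continuous_map_compose[OF f(1) continuous_map_fst]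
      continuous_map_compose[OF f(1) continuous_map_snd]
    by (auto simp: continuous_map_in_subtopology)
  show ?thesis
  proof
    have "closedin (prod_topology Y Y)
        {p \<in> topspace (prod_topology Y Y). (fst \<circ> f) (fst p) = (fst \<circ> f) (snd p)}"
      using continuous_map_compose[OF continuous_map_fst cont(1)]
        continuous_map_compose[OF continuous_map_snd cont(1)]
      by (intro closedin_continuous_maps_eq[OF Hausdorff_cantor_space]) (auto simp: comp_def)
    \<comment> \<open>The non-strict inequality is the complement of the reversed strict one, hence
      the converse.\<close>
    moreover have "closedin (prod_topology Y Y) (topspace (prod_topology Y Y) -
        {p \<in> topspace (prod_topology Y Y). (snd \<circ> f) (fst p) < (snd \<circ> f) (snd p)}\<inverse>)"
    proof -
      have "closedin (prod_topology Y Y) (topspace (prod_topology Y Y) -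
        {p \<in> topspace (prod_topology Y Y). (snd \<circ> f) (fst p) < (snd \<circ> f) (snd p)})"
        using openin_continuous_map_less[OF cont(2)] by blast
      from closedin_prod_converse[OF this] show ?thesis
        by (rule back_subst[where P="closedin _"]) auto
    qed
    ultimately have "closedin (prod_topology Y Y) r"
      by (rule back_subst[where P="closedin _", OF closedin_Int]) (auto simp: r_def)
    moreover have "partial_order_on (topspace Y) r"
      unfolding order_on_defs
    proof (intro conjI)
      show "antisym r"
        by (auto simp: r_def intro!: antisymI inj_onD[OF f(2)] prod_eqI)
    qed (auto simp: r_def refl_on_def trans_def)
    ultimately show clo: "closed_partial_order Y r"
      by (simp add: closed_partial_order_def)
    show "total_on_components Y r"
      unfolding total_on_components_def
    proof
      fix C assume C: "C \<in> connected_components_of Y"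
      have "fst (f x) = fst (f y)" "x \<in> topspace Y" if "x \<in> C" "y \<in> C" for x y
        using connected_component_of_imp_eq_cantor[OF cont(1)] connected_components_ofD[OF C that]
        by auto
      then have "total_on C (Restr r C)"
        unfolding total_on_def r_def using linear by blast
      moreover have "partial_order_on C (Restr r C)"
        using clo connected_components_of_subset[OF C] unfolding closed_partial_order_def order_on_defs
        by (auto simp: refl_on_def intro: trans_Restr antisym_subset)
      ultimately show "linear_order_on C (Restr r C)"
        by (simp add: linear_order_on_def)
    qed
  qed
qed

section \<open>From the order to an injection and a fancy pair\<close>

text \<open>The fibres of \<open>g\<close> are the components, and \<open>h\<close> is injective on
  each of them because their points are comparable. A nonempty vertical section is the image of a
  whole component, hence connected.\<close>

lemma injection_with_connected_sections:
  assumes Y: "compact_space Y" "metrizable_space Y"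
    and r: "closed_partial_order Y r"
    and comp: "\<And>x y. \<lbrakk>x \<in> topspace Y; y \<in> topspace Y; connected_component_of Y x y\<rbrakk> \<Longrightarrow>
       (x, y) \<in> r \<or> (y, x) \<in> r"
  obtains f where "continuous_map Y cantor_times_interval f" "inj_on f (topspace Y)"
    "\<And>x. connectedin cantor_times_interval (f ` topspace Y \<inter> {x} \<times> {0..1})"
proof -
  obtain g where g: "continuous_map Y cantor_space g"
    and g_eq: "\<And>x y. \<lbrakk>x \<in> topspace Y; y \<in> topspace Y\<rbrakk> \<Longrightarrow> g x = g y \<longleftrightarrow> connected_component_of Y x y"
    using component_map_to_cantor_space[OF Y] by blast
  obtain h where h: "continuous_map Y (top_of_set {0..1::real}) h"
    and h_less: "\<And>x y. \<lbrakk>(x, y) \<in> r; x \<noteq> y\<rbrakk> \<Longrightarrow> h x < h y"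
    using closed_partial_order_strict_mono_function[OF Y r] by blast
  define f where "f x = (g x, h x)" for x
  show ?thesis
  proof
    show f: "continuous_map Y cantor_times_interval f"
      unfolding f_def using g h by (simp add: continuous_map_paired)
    show "inj_on f (topspace Y)"
    proof (rule inj_onI)
      fix x y assume "x \<in> topspace Y" "y \<in> topspace Y" "f x = f y"
      then show "x = y"
        using comp[of x y] h_less[of x y] h_less[of y x] g_eq[of x y] by (auto simp: f_def)
    qed
    show "connectedin cantor_times_interval (f ` topspace Y \<inter> {x} \<times> {0..1})" for x
    proof (cases "x \<in> g ` topspace Y")
      case True
      then obtain y where y: "y \<in> topspace Y" "x = g y" by blast
      have "h z \<in> {0..1}" if "z \<in> topspace Y" for z
        using h that by (auto simp: continuous_map_in_subtopology)
      then have "f ` topspace Y \<inter> {x} \<times> {0..1} = f ` {z \<in> topspace Y. g y = g z}"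
        by (auto simp: f_def y(2))
      also have "{z \<in> topspace Y. g y = g z} = connected_component_of_set Y y"
        using g_eq[OF y(1)] connected_component_of_equiv[of Y y] by auto
      finally show ?thesis
        using connectedin_continuous_map_image[OF f connectedin_connected_component_of] by simp
    next
      case False
      then have "f ` topspace Y \<inter> {x} \<times> {0..1} = {}"
        by (auto simp: f_def)
      then show ?thesis by simp
    qed
  qed
qed

text \<open>The image \<open>S\<close> of \<open>f\<close> is compact and its vertical sections are
  compact intervals, empty off the projection \<open>X\<close>. Their endpoints are \<open>m\<close>
  and \<open>M\<close>, so \<open>S\<close> is exactly the region between the two graphs.\<close>

lemma fancy_pair_of_injection:
  assumes Y: "compact_space Y" "topspace Y \<noteq> {}"
    and f: "continuous_map Y cantor_times_interval f" "inj_on f (topspace Y)"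
    and conn: "\<And>x. connectedin cantor_times_interval (f ` topspace Y \<inter> {x} \<times> {0..1})"
  obtains X m M where "closedin cantor_space X" "X \<noteq> {}"
    "fancy_pair (subtopology cantor_space X) m M"
    "Y homeomorphic_space subtopology cantor_times_interval (between_graphs X m M)"
proof -
  define S where "S = f ` topspace Y"
  define X where "X = fst ` S"
  define sec where "sec x = {y. (x, y) \<in> S}" for x
  define m where "m x = Inf (sec x)" for x
  define M where "M x = Sup (sec x)" for x
  have "compactin cantor_times_interval S"
    unfolding S_def using image_compactin f(1) Y(1) compact_space_def by blast
  then have clo: "closedin cantor_times_interval S"
    using compactin_imp_closedin Hausdorff_cantor_times_interval by blast
  have S01: "S \<subseteq> UNIV \<times> {0..1}"
    using closedin_subset[OF clo] by simp
  have I01: "compact_space (top_of_set {0..1::real})"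
    by (simp add: compact_space_subtopology)
  \<comment> \<open>Projecting along the compact unit interval is a closed map. With
    \<open>T\<close> a half-line this later gives semicontinuity, and with \<open>T\<close> the
    whole line it shows that \<open>X\<close> is closed.\<close>
  have proj: "closedin cantor_space (fst ` (S \<inter> UNIV \<times> T))" if "closed T" for T
  proof -
    have "closedin cantor_times_interval (UNIV \<times> ({0..1} \<inter> T))"
      using that closedin_topspace[of cantor_space]
      by (auto simp: closedin_prod_Times_iff closedin_closed_Int)
    then have "closedin cantor_times_interval (S \<inter> UNIV \<times> ({0..1} \<inter> T))"
      using clo by blast
    moreover have "S \<inter> UNIV \<times> ({0..1} \<inter> T) = S \<inter> UNIV \<times> T"
      using S01 by blast
    ultimately show ?thesis
      using closed_map_fst[OF I01, of cantor_space] unfolding closed_map_def by auto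
  qed
  have X: "closedin cantor_space X"
    using proj[of UNIV] by (simp add: X_def)
  have sec_img: "sec x = snd ` (S \<inter> {x} \<times> {0..1})" for x
    using S01 by (force simp: sec_def)
  have snd_cont: "continuous_map cantor_times_interval euclideanreal snd"
    using continuous_map_snd[of cantor_space "top_of_set {0..1::real}"]
    by (simp add: continuous_map_in_subtopology)
  have sec_int: "is_interval (sec x)" for x
    using connectedin_continuous_map_image[OF snd_cont conn[of x]]
    by (simp add: sec_img S_def is_interval_connected_1 connectedin_iff_connected)
  have sec_compact: "compact (sec x)" for x
  proof -
    have "closedin cantor_space {x}"
      by (simp add: closedin_Hausdorff_singleton Hausdorff_cantor_space)
    then have "closedin cantor_times_interval ({x} \<times> {0..1})"
      using closedin_topspace[of "top_of_set {0..1::real}"] by (simp add: closedin_prod_Times_iff)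
    then have "closedin cantor_times_interval (S \<inter> {x} \<times> {0..1})"
      using clo by blast
    then have "compactin cantor_times_interval (S \<inter> {x} \<times> {0..1})"
      using compact_cantor_space I01 by (simp add: closedin_compact_space compact_space_prod_topology)
    then show ?thesis
      using image_compactin[OF _ snd_cont] by (simp add: sec_img)
  qed
  have sec_ne: "sec x \<noteq> {}" if "x \<in> X" for x
    using that by (auto simp: X_def sec_def)
  have sec01: "sec x \<subseteq> {0..1}" for x
    using S01 by (auto simp: sec_def)
  have bdd: "bdd_below (sec x)" "bdd_above (sec x)" for x
    using sec01 bdd_below_mono bdd_above_mono by (metis bdd_below_Icc, metis bdd_above_Icc)
  have mM: "m x \<in> sec x" "M x \<in> sec x" if "x \<in> X" for x
    using closed_contains_Inf[OF sec_ne[OF that] bdd(1)] closed_contains_Sup[OF sec_ne[OF that] bdd(2)]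
      compact_imp_closed[OF sec_compact] by (auto simp: m_def M_def)
  have mM_bd: "m x \<le> y" "y \<le> M x" if "y \<in> sec x" for x y
    using that bdd by (auto simp: m_def M_def cInf_lower cSup_upper)
  \<comment> \<open>An interval that contains its infimum and supremum consists of all points
    between them.\<close>
  have sec_eq: "y \<in> sec x \<longleftrightarrow> m x \<le> y \<and> y \<le> M x" if "x \<in> X" for x y
    using sec_int[of x] mM[OF that] mM_bd unfolding is_interval_1 by blast
  have graphs: "between_graphs X m M = S"
  proof -
    have "(x, y) \<in> between_graphs X m M \<longleftrightarrow> (x, y) \<in> S" for x y
    proof (cases "x \<in> X")
      case True
      then show ?thesis
        using sec_eq[OF True, of y] sec01[of x] by (auto simp: between_graphs_def sec_def)
    next
      case False
      then show ?thesis by (force simp: between_graphs_def X_def)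
    qed
    then show ?thesis by auto
  qed
  show ?thesis
  proof
    show "X \<noteq> {}" using Y(2) by (auto simp: X_def S_def)
    have "{x \<in> X. m x \<le> c} = fst ` (S \<inter> UNIV \<times> {..c})" for c
    proof -
      \<comment> \<open>Since the infimum is attained, the sublevel set of \<open>m\<close> is the
        projection of the part of \<open>S\<close> at height at most \<open>c\<close>. The argument
        for \<open>M\<close> is dual.\<close>
      have "m x \<le> c \<longleftrightarrow> (\<exists>y\<in>sec x. y \<le> c)" if "x \<in> X" for x
        using mM(1)[OF that] mM_bd(1) order_trans by blast
      then have "{x \<in> X. m x \<le> c} = {x \<in> X. \<exists>y\<in>sec x. y \<le> c}"
        by blast
      also have "\<dots> = fst ` (S \<inter> UNIV \<times> {y. y \<le> c})"
        unfolding X_def sec_def by force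
      finally show ?thesis by (simp add: atMost_def atLeast_def)
    qed
    then have "lower_semicontinuous (subtopology cantor_space X) m"
      using proj X by (auto simp: lower_semicontinuous_def closedin_closed_subtopology X_def)
    moreover have "{x \<in> X. M x \<ge> c} = fst ` (S \<inter> UNIV \<times> {c..})" for c
    proof -
      have "M x \<ge> c \<longleftrightarrow> (\<exists>y\<in>sec x. y \<ge> c)" if "x \<in> X" for x
        using mM(2)[OF that] mM_bd(2) order_trans by blast
      then have "{x \<in> X. M x \<ge> c} = {x \<in> X. \<exists>y\<in>sec x. y \<ge> c}"
        by blast
      also have "\<dots> = fst ` (S \<inter> UNIV \<times> {y. y \<ge> c})"
        unfolding X_def sec_def by force
      finally show ?thesis by (simp add: atMost_def atLeast_def)
    qed
    then have "upper_semicontinuous (subtopology cantor_space X) M"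
      using proj X by (auto simp: upper_semicontinuous_def closedin_closed_subtopology X_def)
    ultimately show "fancy_pair (subtopology cantor_space X) m M"
      using mM sec01 mM_bd(1) unfolding fancy_pair_def by auto
    \<comment> \<open>A continuous injection from a compact space into a Hausdorff space is an
      embedding.\<close>
    show "Y homeomorphic_space subtopology cantor_times_interval (between_graphs X m M)"
      unfolding graphs S_def
      using continuous_imp_embedding_map[OF f(1) Y(1) Hausdorff_cantor_times_interval f(2)]
        embedding_map_imp_homeomorphic_space by blast
  qed (rule X)
qed

section \<open>The cycle of implications\<close>

theorem theorem4p2:
  fixes Y :: "'a topology"
  assumes "fence Y" and "topspace Y \<noteq> {}"
  shows
    "(smooth_fence Y \<longleftrightarrow>
       (\<exists>r. closed_partial_order Y r \<and> total_on_components Y r \<and>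
          (\<forall>x \<in> topspace Y. \<forall>y \<in> topspace Y.
             (x, y) \<in> r \<or> (y, x) \<in> r \<longleftrightarrow> connected_component_of Y x y))) \<and>
     (smooth_fence Y \<longleftrightarrow>
       (\<exists>f. continuous_map Y cantor_times_interval f \<and> inj_on f (topspace Y))) \<and>
     (smooth_fence Y \<longleftrightarrow>
       (\<exists>f. continuous_map Y cantor_times_interval f \<and> inj_on f (topspace Y) \<and>
          (\<forall>x \<in> topspace cantor_space.
             connectedin cantor_times_interval (f ` topspace Y \<inter> {x} \<times> {0..1})))) \<and>
     (smooth_fence Y \<longleftrightarrow>
       (\<exists>X m M. closedin cantor_space X \<and> X \<noteq> {} \<and>
          fancy_pair (subtopology cantor_space X) m M \<and>
          Y homeomorphic_space
            subtopology cantor_times_interval (between_graphs X m M)))"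
  (is "(?P1 \<longleftrightarrow> ?P2) \<and> (?P1 \<longleftrightarrow> ?P3) \<and> (?P1 \<longleftrightarrow> ?P4) \<and> (?P1 \<longleftrightarrow> ?P5)")
proof -
  have Y: "compact_space Y" "metrizable_space Y"
    using assms(1) by (auto simp: fence_def)
  \<comment> \<open>The implications run from \<open>?P1\<close> through \<open>?P2\<close>,
    \<open>?P4\<close>, \<open>?P5\<close> and \<open>?P3\<close> back to \<open>?P1\<close>; the
    four equivalences then follow propositionally.\<close>
  have "?P2" if P1: "?P1"
  proof -
    obtain r where r: "closed_partial_order Y r" "total_on_components Y r"
      using P1 by (auto simp: smooth_fence_def)
    show ?thesis
      by (rule closed_partial_order_within_components[OF Y r]) blast
  qed
  moreover have "?P4" if P2: "?P2"
  proof -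
    obtain r where r: "closed_partial_order Y r"
      and comp: "\<And>x y. \<lbrakk>x \<in> topspace Y; y \<in> topspace Y; connected_component_of Y x y\<rbrakk> \<Longrightarrow>
         (x, y) \<in> r \<or> (y, x) \<in> r"
      using P2 by blast
    show ?thesis
      by (rule injection_with_connected_sections[OF Y r comp]) auto
  qed
  \<comment> \<open>Nonemptiness of \<open>Y\<close> enters here: it makes the projection
    \<open>X\<close> of the image nonempty.\<close>
  moreover have "?P5" if P4: "?P4"
  proof -
    obtain f where f: "continuous_map Y cantor_times_interval f" "inj_on f (topspace Y)"
      and conn: "\<And>x. connectedin cantor_times_interval (f ` topspace Y \<inter> {x} \<times> {0..1})"
      using P4 by auto
    show ?thesis
      by (rule fancy_pair_of_injection[OF Y(1) assms(2) f conn]) blast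
  qed
  moreover have "?P3" if P5: "?P5"
  proof -
    obtain X m M f where
      "homeomorphic_map Y (subtopology cantor_times_interval (between_graphs X m M)) f"
      using P5 unfolding homeomorphic_space by blast
    then have "continuous_map Y cantor_times_interval f" "inj_on f (topspace Y)"
      using homeomorphic_imp_continuous_map homeomorphic_imp_injective_map
        continuous_map_into_fulltopology by blast+
    then show ?thesis by blast
  qed
  moreover have "?P1" if P3: "?P3"
  proof -
    obtain f where f: "continuous_map Y cantor_times_interval f" "inj_on f (topspace Y)"
      using P3 by blast
    show ?thesis
      by (rule order_of_continuous_injection[OF f]) (use assms(1) in \<open>auto simp: smooth_fence_def\<close>)
  qed
  ultimately show ?thesis by argo
qed

end
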